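(* For $m\in\mathbb{N}$ let $\mu_m$ be the $m$-monotone central limit law, i.e. the probability measure on $\mathbb{R}$ whose moments are $M^{(m)}_{2k+1}=0$ and $M^{(m)}_{2k}=|\mathcal{ONC}^2_{2k}(m)|/k!$ ($k\ge0$, with $|\mathcal{ONC}^2_0(m)|=1$), and let $G^{(m)}(z)=\int_{\mathbb{R}}\frac{d\mu_m(x)}{z-x}$ be its Cauchy transform. Then for $z\in\mathbb{C}_+=\{z:\mathrm{Im}\,z>0\}$, $$G^{(1)}(z)=\frac{1}{\sqrt{z^2-2}},\qquad G^{(m)}(z)=\frac{1}{z-G^{(m-1)}(z)}\quad\text{for } m\ge2,$$ where the branch of the square root is the one with $\sqrt{z^2-2}\sim z$ as $z\to\infty$.
   Context: An ordered partition of $\{1,\dots,n\}$ is a tuple $P=(P_1,\dots,P_k)$ of pairwise disjoint nonempty sets (blocks) with union $\{1,\dots,n\}$; the index $r$ is the order (color) of $P_r$, and tuples with the same blocks in different order are different ordered partitions. $P$ is non-crossing if there are no $s<r<s'<r'$ with $s,s'\in P_i$, $r,r'\in P_j$, $i\ne j$. Block $P_i$ is inner w.r.t. $P_j$ (written $P_j<P_i$) if there are $p<q$ in $P_j$ with no element of $P_j$ strictly between them and $p<s<q$ for all $s\in P_i$. The depth $d(P_i)$ is $1$ plus the number of blocks w.r.t. which $P_i$ is inner. $\mathcal{ONC}_n(m)$ is the set of ordered non-crossing partitions $P$ of $\{1,\dots,n\}$ such that for all $i,j$: $d(P_j)\ge m$ and $P_j<P_i$ imply $j<i$; $\mathcal{ONC}^2_n(m)$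 is its subset of partitions with all blocks of size two. *)

theory Defs
  imports "HOL-Probability.Probability"
begin

text \<open>An ordered partition of {1..n} is a list of blocks; the list index is the order (colour).\<close>

definition ordered_partition :: "nat \<Rightarrow> nat set list \<Rightarrow> bool" where
  "ordered_partition n P \<longleftrightarrow>
     (\<forall>i<length P. P ! i \<noteq> {}) \<and>
     (\<forall>i<length P. \<forall>j<length P. i \<noteq> j \<longrightarrow> P ! i \<inter> P ! j = {}) \<and>
     \<Union>(set P) = {1..n}"

definition non_crossing :: "nat set list \<Rightarrow> bool" where
  "non_crossing P \<longleftrightarrow>
     \<not> (\<exists>i<length P. \<exists>j<length P. i \<noteq> j \<and>
          (\<exists>s r s' r'. s < r \<and> r < s' \<and> s' < r' \<and>
              s \<in> P ! i \<and> s' \<in> P ! i \<and> r \<in> P ! j \<and> r' \<in> P ! j))"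

definition inner :: "nat set list \<Rightarrow> nat \<Rightarrow> nat \<Rightarrow> bool" where
  "inner P j i \<longleftrightarrow>
     (\<exists>p q. p \<in> P ! j \<and> q \<in> P ! j \<and> p < q \<and>
        (\<forall>t \<in> P ! j. \<not> (p < t \<and> t < q)) \<and>
        (\<forall>s \<in> P ! i. p < s \<and> s < q))"

definition depth :: "nat set list \<Rightarrow> nat \<Rightarrow> nat" where
  "depth P i = 1 + card {j. j < length P \<and> inner P j i}"

definition ONC :: "nat \<Rightarrow> nat \<Rightarrow> nat set list set" where
  "ONC n m = {P. ordered_partition n P \<and> non_crossing P \<and>
     (\<forall>i<length P. \<forall>j<length P. depth P j \<ge> m \<and> inner P j i \<longrightarrow> j < i)}"

definition ONC2 :: "nat \<Rightarrow> nat \<Rightarrow> nat set list set" where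
  "ONC2 n m = {P \<in> ONC n m. \<forall>i<length P. card (P ! i) = 2}"

text \<open>Branch of sqrt(z^2 - 2) on the upper half plane with sqrt(z^2-2) ~ z at infinity:
  z * csqrt(1 - 2/z^2) (principal csqrt; 1 - 2/z^2 avoids (-inf,1] for Im z > 0).\<close>
definition sqrt_z2m2 :: "complex \<Rightarrow> complex" where
  "sqrt_z2m2 z = z * csqrt (1 - 2 / z\<^sup>2)"

definition cauchy_transform :: "real measure \<Rightarrow> complex \<Rightarrow> complex" where
  "cauchy_transform \<mu> z = (\<integral>x. 1 / (z - complex_of_real x) \<partial>\<mu>)"

end

theory Submission
  imports Defs "HOL-Complex_Analysis.Conformal_Mappings"
begin

text \<open>Splitting an ordered non-crossing pairing at the block \<open>{1, 2j}\<close> leaves a pairing of the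
  inside, whose depths drop by one, and a pairing of the outside; no constraint relates the two, so
  their orders are shuffled arbitrarily. For \<open>m \<ge> 2\<close> the outer block itself is unconstrained, so the
  even moments satisfy \<open>A\<^sub>m = 1 + w A\<^bsub>m-1\<^esub> A\<^sub>m\<close> as power series in \<open>w = 1/z\<^sup>2\<close>. For \<open>m = 1\<close> it
  has to come before everything inside, which gives instead the coefficients of
  \<open>1 / sqrt (1 - 2w)\<close>. Since the moments grow at most geometrically, the Cauchy transform equals
  \<open>A\<^sub>m(1/z\<^sup>2)/z\<close> for large \<open>z\<close>, and the identity theorem extends the equations to the upper half
  plane.\<close>

text \<open>Order enters only through a condition on pairs of positions, while nesting and depth see
  only the set of blocks. Keeping the two apart makes list filters the right tool: they preserve
  relative order, and two families of blocks that impose nothing on each other contribute a binomial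
  number of interleavings, which the division by k! absorbs. On the analytic side no bound on the
  supports is assumed, so the geometric series of 1/(z - x) cannot be integrated term by term over
  all real x. A truncated expansion replaces it; its remainder is controlled by a single even moment
  and the distance of z from the real axis. The radius comes from the moment bound (m + 1)^k: the
  base is 2 for m = 1, and passing from one level to the next costs at most one more.\<close>

section \<open>Lists split by a predicate, and their shuffles\<close>

lemma distinct_conv_filter:
  "distinct xs \<longleftrightarrow> distinct (filter U xs) \<and> distinct (filter (\<lambda>x. \<not> U x) xs)"
proof (induction xs)
  case (Cons a xs)
  then show ?case
    by (cases "U a") (auto simp del: distinct_filter)
qed simp

text \<open>Elements of different classes are related in both directions, so only comparisons within
  a class can fail.\<close>

lemma sorted_wrt_conv_filter:
  assumes "\<And>x y. x \<in> set xs \<Longrightarrow> y \<in> set xs \<Longrightarrow> U x \<noteq> U y \<Longrightarrow> R x y"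
  shows "sorted_wrt R xs \<longleftrightarrow>
    sorted_wrt R (filter U xs) \<and> sorted_wrt R (filter (\<lambda>x. \<not> U x) xs)"
  using assms
proof (induction xs)
  case (Cons a xs)
  have IH: "sorted_wrt R xs \<longleftrightarrow>
    sorted_wrt R (filter U xs) \<and> sorted_wrt R (filter (\<lambda>x. \<not> U x) xs)"
    by (rule Cons.IH) (use Cons.prems in auto)
  have a: "\<forall>y\<in>set xs. U a \<noteq> U y \<longrightarrow> R a y"
    using Cons.prems by auto
  show ?case
    unfolding sorted_wrt.simps IH using a by auto
qed simp

lemma sorted_wrt_rel_cong:
  assumes "\<And>x y. x \<in> set xs \<Longrightarrow> y \<in> set xs \<Longrightarrow> R x y = R' x y"
  shows "sorted_wrt R xs = sorted_wrt R' xs"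
  using assms by (induction xs) simp_all

text \<open>The lists with prescribed \<open>U\<close>-part and prescribed complementary part are
  exactly the shuffles of the two parts. The parts share no entry, so there are binomially many
  shuffles, and filtering recovers the parts, so different pairs have disjoint shuffle sets.\<close>

lemma card_filter_pairs:
  assumes fin: "finite A" "finite B"
    and A: "\<And>xs. xs \<in> A \<Longrightarrow> length xs = p \<and> (\<forall>x\<in>set xs. U x)"
    and B: "\<And>xs. xs \<in> B \<Longrightarrow> length xs = q \<and> (\<forall>x\<in>set xs. \<not> U x)"
  shows "card {zs. filter U zs \<in> A \<and> filter (\<lambda>x. \<not> U x) zs \<in> B}
    = (p + q choose p) * (card A * card B)"
proof -
  have mem: "zs \<in> shuffles xs ys \<longleftrightarrow> filter U zs = xs \<and> filter (\<lambda>x. \<not> U x) zs = ys"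
    if "xs \<in> A" "ys \<in> B" for xs ys zs
  proof
    assume zs: "zs \<in> shuffles xs ys"
    have "filter U zs \<in> filter U ` shuffles xs ys"
      and "filter (\<lambda>x. \<not> U x) zs \<in> filter (\<lambda>x. \<not> U x) ` shuffles xs ys"
      using zs by auto
    moreover have "filter U xs = xs" "filter U ys = []"
      "filter (\<lambda>x. \<not> U x) xs = []" "filter (\<lambda>x. \<not> U x) ys = ys"
      using A[OF that(1)] B[OF that(2)] by (auto simp: filter_empty_conv filter_id_conv)
    ultimately show "filter U zs = xs \<and> filter (\<lambda>x. \<not> U x) zs = ys"
      unfolding filter_shuffles by simp
  next
    assume "filter U zs = xs \<and> filter (\<lambda>x. \<not> U x) zs = ys"
    then show "zs \<in> shuffles xs ys"
      using partition_in_shuffles[of zs U] by auto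
  qed
  have eq: "{zs. filter U zs \<in> A \<and> filter (\<lambda>x. \<not> U x) zs \<in> B} =
      (\<Union>(xs, ys)\<in>A \<times> B. shuffles xs ys)"
    by (auto simp: mem)
  have "card (\<Union>(xs, ys)\<in>A \<times> B. shuffles xs ys) = (\<Sum>(xs, ys)\<in>A \<times> B. card (shuffles xs ys))"
    unfolding case_prod_beta
    by (rule card_UN_disjoint) (use fin in \<open>auto simp: mem\<close>)
  also have "\<dots> = (\<Sum>(xs, ys)\<in>A \<times> B. p + q choose p)"
  proof (rule sum.cong[OF refl], clarify)
    fix xs ys assume *: "xs \<in> A" "ys \<in> B"
    have "set xs \<inter> set ys = {}"
      using A[OF *(1)] B[OF *(2)] by auto
    then show "card (shuffles xs ys) = (p + q choose p)"
      using card_disjoint_shuffles[of xs ys] A[OF *(1)] B[OF *(2)] by simp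
  qed
  finally show ?thesis
    unfolding eq by (simp add: card_cartesian_product)
qed

subsection \<open>Decomposition of ordered non-crossing pairings\<close>

text \<open>Counterpart of \<open>inner\<close> on blocks instead of indices, with the enclosing
  block as first argument. Together with \<open>crossing\<close> and \<open>block_depth\<close> it
  describes the shape of a pairing without reference to the order of its blocks.\<close>

definition nested :: "nat set \<Rightarrow> nat set \<Rightarrow> bool" where
  "nested B C \<longleftrightarrow> (\<exists>p q. p \<in> B \<and> q \<in> B \<and> p < q \<and> (\<forall>t\<in>B. \<not> (p < t \<and> t < q)) \<and>
     (\<forall>s\<in>C. p < s \<and> s < q))"

definition crossing :: "nat set \<Rightarrow> nat set \<Rightarrow> bool" where
  "crossing B C \<longleftrightarrow> (\<exists>s r s' r'. s < r \<and> r < s' \<and> s' < r' \<and> s \<in> B \<and> s' \<in> B \<and> r \<in> C \<and> r' \<in> C)"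

definition block_depth :: "nat set set \<Rightarrow> nat set \<Rightarrow> nat" where
  "block_depth S B = 1 + card {C \<in> S. nested C B}"

definition nc_pairings :: "nat set \<Rightarrow> nat set set set" where
  "nc_pairings X = {S. (\<forall>B\<in>S. card B = 2) \<and> disjoint S \<and> \<Union>S = X \<and>
     (\<forall>B\<in>S. \<forall>C\<in>S. B \<noteq> C \<longrightarrow> \<not> crossing B C)}"

text \<open>The negation of a violated order constraint, so that \<open>sorted_wrt\<close> expresses
  all constraints at once. The family \<open>S\<close> is a parameter because depths are taken in
  the whole pairing and may change when blocks are removed.\<close>

definition may_precede :: "nat \<Rightarrow> nat set set \<Rightarrow> nat set \<Rightarrow> nat set \<Rightarrow> bool" where
  "may_precede m S B C \<longleftrightarrow> \<not> (m \<le> block_depth S C \<and> nested C B)"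

definition ordered_pairings :: "nat \<Rightarrow> nat set \<Rightarrow> nat set list set" where
  "ordered_pairings m X =
     {P. distinct P \<and> set P \<in> nc_pairings X \<and> sorted_wrt (may_precede m (set P)) P}"

lemma nested_pair: "p < q \<Longrightarrow> nested {p, q} C \<longleftrightarrow> (\<forall>s\<in>C. p < s \<and> s < q)"
proof -
  assume pq: "p < q"
  have "p' = p \<and> q' = q" if "p' \<in> {p, q}" "q' \<in> {p, q}" "p' < q'" for p' q'
    using that pq by auto
  moreover have "\<not> (p < t \<and> t < q)" if "t \<in> {p, q}" for t
    using that by auto
  ultimately show ?thesis unfolding nested_def using pq by blast
qed

lemma not_nested_self: "\<not> nested B B"
  unfolding nested_def by (meson less_irrefl)

lemma not_nested_separated:
  assumes "\<And>x y. x \<in> B \<Longrightarrow> y \<in> C \<Longrightarrow> x < y" "B \<noteq> {}" "C \<noteq> {}"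
  shows "\<not> nested B C" "\<not> nested C B"
proof -
  obtain x y where "x \<in> B" "y \<in> C" using assms(2,3) by blast
  then show "\<not> nested B C" "\<not> nested C B"
    unfolding nested_def using assms(1) by (meson less_asym)+
qed

text \<open>Blocks are nonempty and pairwise disjoint, so the list has no repetition and an index
  can be traded for its block. The order condition over all pairs of indices reduces to pairs
  \<open>i < j\<close>, since no block is nested in itself.\<close>

lemma ONC2_eq_ordered_pairings: "ONC2 n m = ordered_pairings m {1..n}"
proof -
  have "P \<in> ONC2 n m \<longleftrightarrow> P \<in> ordered_pairings m {1..n}" (is "?L \<longleftrightarrow> ?R") for P
  proof -
    have dist: "distinct P"
      if "ordered_partition n P"
      unfolding distinct_conv_nth using that unfolding ordered_partition_def by (metis Int_absorb)
    have part: "ordered_partition n P \<longleftrightarrow> disjoint (set P) \<and> \<Union>(set P) = {1..n}"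
      if "distinct P" "\<forall>B\<in>set P. card B = 2"
    proof -
      have "\<forall>i<length P. P ! i \<noteq> {}"
        using that(2) by (metis card.empty nth_mem zero_neq_numeral)
      moreover have "(\<forall>i<length P. \<forall>j<length P. i \<noteq> j \<longrightarrow> P ! i \<inter> P ! j = {}) \<longleftrightarrow> disjoint (set P)"
        unfolding disjoint_def all_set_conv_all_nth
        using that(1) by (auto simp: nth_eq_iff_index_eq)
      ultimately show ?thesis
        unfolding ordered_partition_def by blast
    qed
    have nc: "non_crossing P \<longleftrightarrow> (\<forall>B\<in>set P. \<forall>C\<in>set P. B \<noteq> C \<longrightarrow> \<not> crossing B C)" if "distinct P"
      unfolding non_crossing_def crossing_def[symmetric] all_set_conv_all_nth
      using that by (auto simp: nth_eq_iff_index_eq)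
    have dep: "depth P i = block_depth (set P) (P ! i)" if "distinct P" for i
    proof -
      have "bij_betw ((!) P) {j. j < length P \<and> inner P j i} {C \<in> set P. nested C (P ! i)}"
        unfolding inner_def nested_def[symmetric]
        by (rule bij_betw_imageI)
          (use that in \<open>auto simp: inj_on_def nth_eq_iff_index_eq in_set_conv_nth\<close>)
      then show ?thesis
        unfolding depth_def block_depth_def by (simp add: bij_betw_same_card)
    qed
    have srt: "(\<forall>i<length P. \<forall>j<length P. depth P j \<ge> m \<and> inner P j i \<longrightarrow> j < i) \<longleftrightarrow>
        sorted_wrt (may_precede m (set P)) P" if "distinct P" "\<forall>B\<in>set P. card B = 2"
    proof -
      show ?thesis
        unfolding sorted_wrt_iff_nth_less may_precede_def inner_def nested_def[symmetric] dep[OF that(1)]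
      proof (intro iffI allI impI notI)
        fix i j
        assume *: "\<forall>i<length P. \<forall>j<length P.
            m \<le> block_depth (set P) (P ! j) \<and> nested (P ! j) (P ! i) \<longrightarrow> j < i"
          and ij: "i < j" "j < length P"
            "m \<le> block_depth (set P) (P ! j) \<and> nested (P ! j) (P ! i)"
        then have "j < i" using * by auto
        with ij show False by simp
      next
        fix i j
        assume *: "\<forall>i j. i < j \<longrightarrow> j < length P \<longrightarrow>
            \<not> (m \<le> block_depth (set P) (P ! j) \<and> nested (P ! j) (P ! i))"
          and ij: "i < length P" "j < length P"
            "m \<le> block_depth (set P) (P ! j) \<and> nested (P ! j) (P ! i)"
        then have "\<not> i < j" by blast
        moreover have "i \<noteq> j" using not_nested_self ij by auto
        ultimately show "j < i" by simp
      qed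
    qed
    have c2: "(\<forall>i<length P. card (P ! i) = 2) \<longleftrightarrow> (\<forall>B\<in>set P. card B = 2)"
      by (simp add: all_set_conv_all_nth)
    show ?thesis
    proof
      assume ?L
      then have P: "ordered_partition n P" "\<forall>B\<in>set P. card B = 2"
        using c2 unfolding ONC2_def ONC_def by auto
      with \<open>?L\<close> show ?R
        using part[OF dist[OF P(1)] P(2)] nc[OF dist[OF P(1)]] srt[OF dist[OF P(1)] P(2)] dist[OF P(1)]
        unfolding ONC2_def ONC_def ordered_pairings_def nc_pairings_def by auto
    next
      assume ?R
      then have P: "distinct P" "\<forall>B\<in>set P. card B = 2"
        unfolding ordered_pairings_def nc_pairings_def by auto
      with \<open>?R\<close> show ?L
        using part[OF P] nc[OF P(1)] srt[OF P] c2
        unfolding ONC2_def ONC_def ordered_pairings_def nc_pairings_def by auto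
    qed
  qed
  then show ?thesis by blast
qed

section \<open>Elementary properties of non-crossing pairings\<close>

lemma nc_pairings_block:
  assumes "S \<in> nc_pairings X" "B \<in> S"
  shows "B \<noteq> {}" "B \<subseteq> X" "card B = 2"
proof -
  have "\<Union>S = X" using assms(1) by (simp add: nc_pairings_def)
  with assms(2) show "B \<subseteq> X" by blast
  show "card B = 2" using assms by (simp add: nc_pairings_def)
  then show "B \<noteq> {}" by auto
qed

lemma nc_pairings_disjoint:
  "S \<in> nc_pairings X \<Longrightarrow> B \<in> S \<Longrightarrow> C \<in> S \<Longrightarrow> B \<noteq> C \<Longrightarrow> B \<inter> C = {}"
  unfolding nc_pairings_def disjoint_def by simp

lemma nc_pairings_not_crossing:
  "S \<in> nc_pairings X \<Longrightarrow> B \<in> S \<Longrightarrow> C \<in> S \<Longrightarrow> B \<noteq> C \<Longrightarrow> \<not> crossing B C"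
  unfolding nc_pairings_def by simp

lemma nc_pairings_card:
  assumes "S \<in> nc_pairings X" "finite X"
  shows "card X = 2 * card S"
proof -
  have "card (\<Union>S) = sum card S"
    by (rule card_Union_disjoint)
      (use assms in \<open>auto simp: nc_pairings_def disjoint_def pairwise_def disjnt_def intro: card_ge_0_finite\<close>)
  also have "\<dots> = (\<Sum>B\<in>S. 2)"
    by (rule sum.cong) (use assms in \<open>auto simp: nc_pairings_def\<close>)
  finally show ?thesis
    using assms by (simp add: nc_pairings_def)
qed

lemma ordered_pairings_length:
  "P \<in> ordered_pairings m X \<Longrightarrow> finite X \<Longrightarrow> card X = 2 * length P"
  unfolding ordered_pairings_def using nc_pairings_card[of "set P" X] distinct_card[of P] by simp

lemma finite_ordered_pairings:
  assumes "finite X"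
  shows "finite (ordered_pairings m X)"
proof (rule finite_subset)
  show "ordered_pairings m X \<subseteq> {P. set P \<subseteq> Pow X \<and> distinct P}"
    unfolding ordered_pairings_def using nc_pairings_block(2) by blast
  show "finite {P. set P \<subseteq> Pow X \<and> distinct P}"
    by (rule finite_subset_distinct) (use assms in simp)
qed

lemma ordered_pairings_empty: "ordered_pairings m {} = {[]}"
proof (intro equalityI subsetI)
  fix P assume "P \<in> ordered_pairings m {}"
  then have "length P = 0" using ordered_pairings_length[of P m "{}"] by simp
  then show "P \<in> {[]}" by simp
next
  fix P :: "nat set list"
  assume "P \<in> {[]}"
  moreover have "{} \<in> nc_pairings {}"
    by (simp add: nc_pairings_def disjoint_def)
  ultimately show "P \<in> ordered_pairings m {}"
    by (simp add: ordered_pairings_def)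
qed

lemma ordered_pairings_0: "ordered_pairings 0 X = ordered_pairings 1 X"
proof -
  have "may_precede 0 = may_precede 1"
    by (intro ext) (simp add: may_precede_def block_depth_def)
  then show ?thesis unfolding ordered_pairings_def by (simp only:)
qed

section \<open>Cutting a pairing behind the partner of 1 and removing the outer block\<close>

lemma nc_pairings_restrict:
  assumes "S \<in> nc_pairings X" "Y \<subseteq> X" "\<And>B. B \<in> S \<Longrightarrow> B \<subseteq> Y \<or> B \<inter> Y = {}"
  shows "{B \<in> S. B \<subseteq> Y} \<in> nc_pairings Y"
proof -
  have "\<Union>{B \<in> S. B \<subseteq> Y} = Y"
  proof -
    have "x \<in> \<Union>{B \<in> S. B \<subseteq> Y}" if x: "x \<in> Y" for x
    proof -
      obtain B where "B \<in> S" "x \<in> B"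
        using x assms(1,2) unfolding nc_pairings_def by auto
      then show ?thesis using assms(3)[of B] x by auto
    qed
    then show ?thesis by auto
  qed
  then show ?thesis
    using assms(1) unfolding nc_pairings_def by (auto simp: disjoint_def)
qed

lemma nc_pairings_Un:
  assumes "S \<in> nc_pairings X" "T \<in> nc_pairings Y" "\<And>x y. x \<in> X \<Longrightarrow> y \<in> Y \<Longrightarrow> x < y"
  shows "S \<union> T \<in> nc_pairings (X \<union> Y)"
proof -
  have dj: "X \<inter> Y = {}" using assms(3) by fastforce
  have sep: "x < y" if "B \<in> S" "C \<in> T" "x \<in> B" "y \<in> C" for B C x y
    using assms that nc_pairings_block(2) by blast
  have cr: "\<not> crossing B C" "\<not> crossing C B" if "B \<in> S" "C \<in> T" for B C
    unfolding crossing_def using sep[OF that] by (meson less_asym)+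
  have "disjoint (S \<union> T)"
    by (rule disjoint_union) (use assms dj in \<open>auto simp: nc_pairings_def\<close>)
  then show ?thesis
    using assms(1,2) cr unfolding nc_pairings_def by auto
qed

text \<open>A block with points on both sides of \<open>q\<close> would cross \<open>{1, q}\<close>,
  so every block lies in \<open>{1..q}\<close> or beyond it. Conversely, blocks of two separated
  intervals can neither meet nor cross.\<close>

lemma nc_pairings_split:
  assumes "1 < q" "q \<le> n"
  shows "S \<in> nc_pairings {1..n} \<and> {1, q} \<in> S \<longleftrightarrow>
    ({B \<in> S. B \<subseteq> {1..q}} \<in> nc_pairings {1..q} \<and> {1, q} \<in> S) \<and>
    {B \<in> S. \<not> B \<subseteq> {1..q}} \<in> nc_pairings {q + 1..n}" (is "?L \<longleftrightarrow> ?R")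
proof
  assume L: ?L
  have dich: "B \<subseteq> {1..q} \<or> B \<subseteq> {q + 1..n}" if "B \<in> S" for B
  proof (cases "B = {1, q}")
    case False
    have sub: "B \<subseteq> {1..n}" using L that nc_pairings_block(2) by blast
    have "{1, q} \<inter> B = {}"
      using nc_pairings_disjoint[of S _ "{1, q}" B] L that False by auto
    then have nin: "1 \<notin> B" "q \<notin> B" by auto
    have "\<not> (x < q \<and> q < y)" if "x \<in> B" "y \<in> B" for x y
    proof
      assume *: "x < q \<and> q < y"
      have "1 < x" using sub that(1) nin by (metis atLeastAtMost_iff in_mono le_neq_implies_less)
      with * have "crossing {1, q} B"
        unfolding crossing_def using that by blast
      with nc_pairings_not_crossing[of S _ "{1, q}" B] L \<open>B \<in> S\<close> False show False by auto
    qed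
    then have "(\<forall>x\<in>B. x < q) \<or> (\<forall>x\<in>B. q < x)"
      using nin by (metis linorder_neqE_nat)
    with sub show ?thesis by fastforce
  qed (use assms in auto)
  have ne: "B \<noteq> {}" if "B \<in> S" for B using L that nc_pairings_block(1) by blast
  have "{B \<in> S. B \<subseteq> {1..q}} \<in> nc_pairings {1..q}"
    by (rule nc_pairings_restrict[of S "{1..n}"]) (use L assms dich in fastforce)+
  moreover have "{B \<in> S. B \<subseteq> {q + 1..n}} \<in> nc_pairings {q + 1..n}"
    by (rule nc_pairings_restrict[of S "{1..n}"]) (use L assms dich in fastforce)+
  moreover have "{B \<in> S. B \<subseteq> {q + 1..n}} = {B \<in> S. \<not> B \<subseteq> {1..q}}"
    using dich ne by fastforce
  ultimately show ?R using L by simp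
next
  assume R: ?R
  have "{B \<in> S. B \<subseteq> {1..q}} \<union> {B \<in> S. \<not> B \<subseteq> {1..q}} \<in> nc_pairings ({1..q} \<union> {q + 1..n})"
    by (rule nc_pairings_Un) (use R in auto)
  moreover have "{B \<in> S. B \<subseteq> {1..q}} \<union> {B \<in> S. \<not> B \<subseteq> {1..q}} = S" by auto
  moreover have "{1..q} \<union> {q + 1..n} = {1..n}" using assms by auto
  ultimately show ?L using R by simp
qed

text \<open>A crossing with \<open>{1, q}\<close> would require a point of the other block below 1
  or above \<open>q\<close>, but all other blocks lie strictly between.\<close>

lemma nc_pairings_outer:
  assumes "1 < q" "{1, q} \<in> S"
  shows "S \<in> nc_pairings {1..q} \<longleftrightarrow> {B \<in> S. B \<noteq> {1, q}} \<in> nc_pairings {2..q - 1}" (is "?L \<longleftrightarrow> ?R")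
proof
  assume L: ?L
  have sub: "B \<subseteq> {2..q - 1}" if "B \<in> S" "B \<noteq> {1, q}" for B
  proof
    fix x assume x: "x \<in> B"
    have "{1, q} \<inter> B = {}"
      using nc_pairings_disjoint[OF L assms(2) that(1)] that(2) by auto
    then have "x \<noteq> 1" "x \<noteq> q" using x by auto
    moreover have "x \<in> {1..q}" using L that x nc_pairings_block(2) by blast
    ultimately show "x \<in> {2..q - 1}" by auto
  qed
  have "{B \<in> S. B \<subseteq> {2..q - 1}} \<in> nc_pairings {2..q - 1}"
    by (rule nc_pairings_restrict[OF L]) (use sub in \<open>fastforce+\<close>)
  moreover have "{B \<in> S. B \<subseteq> {2..q - 1}} = {B \<in> S. B \<noteq> {1, q}}"
    using sub by auto
  ultimately show ?R by simp
next
  assume R: ?R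
  have sub: "B \<subseteq> {2..q - 1}" if "B \<in> S" "B \<noteq> {1, q}" for B
    using R that nc_pairings_block(2) by blast
  have S: "S = insert {1, q} {B \<in> S. B \<noteq> {1, q}}" using assms by auto
  have "disjoint S"
    unfolding disjoint_def
  proof (intro ballI impI)
    fix B C assume BC: "B \<in> S" "C \<in> S" "B \<noteq> C"
    show "B \<inter> C = {}"
    proof (cases "B = {1, q} \<or> C = {1, q}")
      case True
      then show ?thesis using sub[of B] sub[of C] BC by fastforce
    next
      case False
      then show ?thesis using nc_pairings_disjoint[OF R] BC by simp
    qed
  qed
  moreover have "\<not> crossing B C" if BC: "B \<in> S" "C \<in> S" "B \<noteq> C" for B C
  proof -
    consider "B = {1, q}" | "C = {1, q}" | "B \<noteq> {1, q}" "C \<noteq> {1, q}" by blast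
    then show ?thesis
    proof cases
      case 1
      then have "\<forall>x\<in>C. 1 < x \<and> x < q" using sub[of C] BC by fastforce
      then have "r' < s'" if "s < s'" "s \<in> {1, q}" "s' \<in> {1, q}" "r' \<in> C" for s s' r'
        using that by auto
      then show ?thesis unfolding crossing_def 1 by (meson less_asym less_trans)
    next
      case 2
      then have "\<forall>x\<in>B. 1 < x \<and> x < q" using sub[of B] BC by fastforce
      then have "s' < r" if "r < r'" "s < r" "s \<in> B" "s' \<in> B" "r \<in> {1, q}" for s s' r r'
        using that by auto
      then show ?thesis unfolding crossing_def 2 by (meson less_asym less_trans)
    next
      case 3
      then show ?thesis using nc_pairings_not_crossing[OF R] BC by simp
    qed
  qed
  moreover have "\<Union>S = {1..q}"
  proof -
    have "\<Union>S = {1, q} \<union> {2..q - 1}"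
      using R by (subst S) (auto simp: nc_pairings_def)
    also have "\<dots> = {1..q}" using assms(1) by auto
    finally show ?thesis .
  qed
  moreover have "card B = 2" if "B \<in> S" for B
    using R that assms(1) unfolding nc_pairings_def by (cases "B = {1, q}") auto
  ultimately show ?L
    unfolding nc_pairings_def by blast
qed


definition headed_pairings :: "nat \<Rightarrow> nat \<Rightarrow> nat set list set" where
  "headed_pairings m q = {P \<in> ordered_pairings m {1..q}. {1, q} \<in> set P}"

text \<open>Blocks on different sides of the cut are never nested. Hence neither side affects the
  depths of the other, and \<open>may_precede\<close> holds across the cut in both directions, so
  the constraints decouple.\<close>

lemma ordered_pairings_split:
  assumes "1 < q" "q \<le> n"
  shows "P \<in> ordered_pairings m {1..n} \<and> {1, q} \<in> set P \<longleftrightarrow>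
    filter (\<lambda>B. B \<subseteq> {1..q}) P \<in> headed_pairings m q \<and>
    filter (\<lambda>B. \<not> B \<subseteq> {1..q}) P \<in> ordered_pairings m {q + 1..n}"
proof -
  let ?U = "\<lambda>B. B \<subseteq> {1..q}"
  let ?S1 = "{B \<in> set P. ?U B}" and ?S2 = "{B \<in> set P. \<not> ?U B}"
  have sorted: "sorted_wrt (may_precede m (set P)) P \<longleftrightarrow>
      sorted_wrt (may_precede m ?S1) (filter ?U P) \<and>
      sorted_wrt (may_precede m ?S2) (filter (\<lambda>B. \<not> ?U B) P)"
    if S1: "?S1 \<in> nc_pairings {1..q}" and S2: "?S2 \<in> nc_pairings {q + 1..n}"
  proof -
    have nn: "\<not> nested B C" "\<not> nested C B" if "B \<in> ?S1" "C \<in> ?S2" for B C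
    proof -
      have "x < y" if "x \<in> B" "y \<in> C" for x y
        using nc_pairings_block(2)[OF S1 \<open>B \<in> ?S1\<close>] nc_pairings_block(2)[OF S2 \<open>C \<in> ?S2\<close>] that
        by fastforce
      moreover have "B \<noteq> {}" "C \<noteq> {}"
        using nc_pairings_block(1)[OF S1 that(1)] nc_pairings_block(1)[OF S2 that(2)] .
      ultimately show "\<not> nested B C" "\<not> nested C B"
        using not_nested_separated by blast+
    qed
    have d1: "block_depth (set P) B = block_depth ?S1 B" if "B \<in> ?S1" for B
    proof -
      have "{C \<in> set P. nested C B} = {C \<in> ?S1. nested C B}"
        using nn that by blast
      then show ?thesis unfolding block_depth_def by presburger
    qed
    have d2: "block_depth (set P) B = block_depth ?S2 B" if "B \<in> ?S2" for B
    proof -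
      have "{C \<in> set P. nested C B} = {C \<in> ?S2. nested C B}"
        using nn that by blast
      then show ?thesis unfolding block_depth_def by presburger
    qed
    have "sorted_wrt (may_precede m (set P)) P \<longleftrightarrow>
      sorted_wrt (may_precede m (set P)) (filter ?U P) \<and>
      sorted_wrt (may_precede m (set P)) (filter (\<lambda>B. \<not> ?U B) P)"
      by (rule sorted_wrt_conv_filter) (use nn in \<open>unfold may_precede_def, blast\<close>)
    also have "sorted_wrt (may_precede m (set P)) (filter ?U P) \<longleftrightarrow>
        sorted_wrt (may_precede m ?S1) (filter ?U P)"
      by (rule sorted_wrt_rel_cong) (use d1 in \<open>simp add: may_precede_def\<close>)
    also have "sorted_wrt (may_precede m (set P)) (filter (\<lambda>B. \<not> ?U B) P) \<longleftrightarrow>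
        sorted_wrt (may_precede m ?S2) (filter (\<lambda>B. \<not> ?U B) P)"
      by (rule sorted_wrt_rel_cong) (use d2 in \<open>simp add: may_precede_def\<close>)
    finally show ?thesis .
  qed
  have "P \<in> ordered_pairings m {1..n} \<and> {1, q} \<in> set P \<longleftrightarrow>
      distinct P \<and> (set P \<in> nc_pairings {1..n} \<and> {1, q} \<in> set P) \<and>
      sorted_wrt (may_precede m (set P)) P"
    unfolding ordered_pairings_def by auto
  also have "\<dots> \<longleftrightarrow> (distinct (filter ?U P) \<and> distinct (filter (\<lambda>B. \<not> ?U B) P)) \<and>
      ((?S1 \<in> nc_pairings {1..q} \<and> {1, q} \<in> set P) \<and> ?S2 \<in> nc_pairings {q + 1..n}) \<and>
      sorted_wrt (may_precede m ?S1) (filter ?U P) \<and>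
      sorted_wrt (may_precede m ?S2) (filter (\<lambda>B. \<not> ?U B) P)"
    unfolding distinct_conv_filter[of P ?U] nc_pairings_split[OF assms] using sorted by blast
  also have "\<dots> \<longleftrightarrow> filter ?U P \<in> headed_pairings m q \<and>
      filter (\<lambda>B. \<not> ?U B) P \<in> ordered_pairings m {q + 1..n}"
    unfolding headed_pairings_def ordered_pairings_def using assms by auto
  finally show ?thesis .
qed

text \<open>For \<open>m = 1\<close> the inside carries the index \<open>0\<close>; since depths are positive, it imposes the same
  constraints as \<open>1\<close>.\<close>

lemma headed_pairings_outer:
  assumes "1 < q"
  shows "P \<in> headed_pairings m q \<longleftrightarrow>
    filter (\<lambda>B. B = {1, q}) P = [{1, q}] \<and>
    filter (\<lambda>B. B \<noteq> {1, q}) P \<in> ordered_pairings (m - 1) {2..q - 1} \<and>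
    (m \<le> 1 \<longrightarrow> hd P = {1, q})"
proof -
  let ?b = "{1, q}"
  let ?S = "{B \<in> set P. B \<noteq> ?b}"
  \<comment> \<open>That \<open>?b\<close> occurs exactly once is recorded as a filter equation, the
    form in which \<open>card_filter_pairs\<close> can use it.\<close>
  have single: "distinct P \<and> ?b \<in> set P \<longleftrightarrow>
      filter (\<lambda>B. B = ?b) P = [?b] \<and> distinct (filter (\<lambda>B. B \<noteq> ?b) P)"
  proof (induction P)
    case (Cons a P)
    then show ?case
      by (cases "a = ?b") (auto simp: filter_empty_conv)
  qed simp
  have sorted: "sorted_wrt (may_precede m (set P)) P \<longleftrightarrow>
      sorted_wrt (may_precede (m - 1) ?S) (filter (\<lambda>B. B \<noteq> ?b) P) \<and> (m \<le> 1 \<longrightarrow> hd P = ?b)"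
    if S: "?S \<in> nc_pairings {2..q - 1}" and b: "?b \<in> set P" and P: "distinct P"
  proof -
    have ins: "1 < x \<and> x < q" if "B \<in> ?S" "x \<in> B" for B x
      using nc_pairings_block(2)[OF S that(1)] that(2) by fastforce
    have nb: "nested ?b B" if "B \<in> ?S" for B
      using nested_pair[OF assms] ins[OF that] by auto
    have bn: "\<not> nested B ?b" if "B \<in> set P" for B
    proof
      assume "nested B ?b"
      then obtain p where p: "p \<in> B" "p < 1" "p < q" unfolding nested_def by auto
      then have "B \<noteq> ?b" by auto
      with ins[of B p] that p show False by simp
    qed
    \<comment> \<open>The outer block encloses every other block and so adds exactly one to each
      depth; this is why the threshold drops from \<open>m\<close> to \<open>m - 1\<close>.\<close>
    have d: "block_depth (set P) B = Suc (block_depth ?S B)" if "B \<in> ?S" for B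
    proof -
      have "{C \<in> set P. nested C B} = insert ?b {C \<in> ?S. nested C B}"
        using nb[OF that] b by auto
      moreover have "finite {C \<in> ?S. nested C B}" by simp
      ultimately show ?thesis unfolding block_depth_def by simp
    qed
    have "{C \<in> set P. nested C ?b} = {}" using bn by auto
    then have db: "block_depth (set P) ?b = 1" unfolding block_depth_def by (simp only: card.empty)
    have inner: "sorted_wrt (may_precede m (set P)) (filter (\<lambda>B. B \<noteq> ?b) P) \<longleftrightarrow>
        sorted_wrt (may_precede (m - 1) ?S) (filter (\<lambda>B. B \<noteq> ?b) P)"
    proof (rule sorted_wrt_rel_cong)
      fix B C assume "C \<in> set (filter (\<lambda>B. B \<noteq> ?b) P)"
      then have "block_depth (set P) C = Suc (block_depth ?S C)" by (intro d) simp
      \<comment> \<open>\<open>m \<le> Suc d\<close> and \<open>m - 1 \<le> d\<close> agree for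
        every \<open>m\<close>, also for \<open>m = 0\<close> with truncated subtraction.\<close>
      then show "may_precede m (set P) B C = may_precede (m - 1) ?S B C"
        unfolding may_precede_def by (simp only: le_diff_conv) simp
    qed
    show ?thesis
    proof (cases "m \<le> 1")
      case False
      have "sorted_wrt (may_precede m (set P)) P \<longleftrightarrow>
          sorted_wrt (may_precede m (set P)) (filter (\<lambda>B. B = ?b) P) \<and>
          sorted_wrt (may_precede m (set P)) (filter (\<lambda>B. B \<noteq> ?b) P)"
        \<comment> \<open>The outer block has depth 1, below the threshold, and nothing encloses it;
          so it may stand anywhere.\<close>
        by (rule sorted_wrt_conv_filter) (use bn db False in \<open>auto simp: may_precede_def\<close>)
      moreover have "filter (\<lambda>B. B = ?b) P = [?b]" using single b P by blast
      ultimately show ?thesis using inner False by simp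
    next
      case True
      obtain a P' where aP: "P = a # P'" using b by (cases P) auto
      show ?thesis
      proof (cases "a = ?b")
        case True
        have f: "filter (\<lambda>B. B \<noteq> ?b) P = P'"
          using P unfolding aP True by (auto simp: filter_id_conv)
        have "may_precede m (set P) ?b B" if "B \<in> set P'" for B
          unfolding may_precede_def using bn[of B] that by (simp add: aP)
        then have "sorted_wrt (may_precede m (set P)) P \<longleftrightarrow> sorted_wrt (may_precede m (set P)) P'"
          by (subst (2) aP) (auto simp: True)
        also have "\<dots> \<longleftrightarrow> sorted_wrt (may_precede (m - 1) ?S) P'"
          using inner unfolding f .
        finally show ?thesis unfolding f by (simp add: aP True)
      next
        case False
        \<comment> \<open>The outer block reaches the threshold \<open>m \<le> 1\<close>, so an
          enclosed block at the head of the list already violates the constraint.\<close>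
        have "\<not> may_precede m (set P) a ?b"
          unfolding may_precede_def db using nb[of a] False \<open>m \<le> 1\<close> by (simp add: aP)
        moreover have "?b \<in> set P'" using b False by (simp add: aP)
        ultimately have "\<not> sorted_wrt (may_precede m (set P)) P"
          by (subst (2) aP) auto
        then show ?thesis using \<open>m \<le> 1\<close> False by (simp add: aP)
      qed
    qed
  qed
  have "P \<in> headed_pairings m q \<longleftrightarrow>
      (distinct P \<and> ?b \<in> set P) \<and> ?S \<in> nc_pairings {2..q - 1} \<and>
      sorted_wrt (may_precede m (set P)) P"
    unfolding headed_pairings_def ordered_pairings_def using nc_pairings_outer[OF assms] by auto
  also have "\<dots> \<longleftrightarrow> (distinct P \<and> ?b \<in> set P) \<and> ?S \<in> nc_pairings {2..q - 1} \<and>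
      sorted_wrt (may_precede (m - 1) ?S) (filter (\<lambda>B. B \<noteq> ?b) P) \<and> (m \<le> 1 \<longrightarrow> hd P = ?b)"
    using sorted by blast
  also have "\<dots> \<longleftrightarrow> filter (\<lambda>B. B = ?b) P = [?b] \<and>
      filter (\<lambda>B. B \<noteq> ?b) P \<in> ordered_pairings (m - 1) {2..q - 1} \<and> (m \<le> 1 \<longrightarrow> hd P = ?b)"
    unfolding single ordered_pairings_def by auto
  finally show ?thesis .
qed

section \<open>Invariance under strictly increasing relabelling\<close>

lemma nested_image:
  assumes "strict_mono (f :: nat \<Rightarrow> nat)"
  shows "nested (f ` B) (f ` C) \<longleftrightarrow> nested B C"
proof -
  have "nested B C \<longleftrightarrow> (\<exists>p\<in>B. \<exists>q\<in>B. p < q \<and> (\<forall>t\<in>B. \<not> (p < t \<and> t < q)) \<and>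
     (\<forall>s\<in>C. p < s \<and> s < q))" for B C
    unfolding nested_def by blast
  then show ?thesis by (simp add: strict_mono_less[OF assms])
qed

lemma crossing_image:
  assumes "strict_mono (f :: nat \<Rightarrow> nat)"
  shows "crossing (f ` B) (f ` C) \<longleftrightarrow> crossing B C"
proof -
  have "crossing B C \<longleftrightarrow> (\<exists>s\<in>B. \<exists>r\<in>C. \<exists>s'\<in>B. \<exists>r'\<in>C. s < r \<and> r < s' \<and> s' < r')" for B C
    unfolding crossing_def by blast
  then show ?thesis by (simp add: strict_mono_less[OF assms])
qed

lemma nc_pairings_image:
  assumes f: "strict_mono (f :: nat \<Rightarrow> nat)"
  shows "(`) f ` S \<in> nc_pairings (f ` X) \<longleftrightarrow> S \<in> nc_pairings X"
proof -
  have inj: "inj f" using f by (rule strict_mono_imp_inj_on)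
  have "disjoint ((`) f ` S) \<longleftrightarrow> disjoint S"
    unfolding disjoint_def by (auto simp: inj_image_eq_iff[OF inj] image_Int[OF inj, symmetric])
  moreover have "\<Union>((`) f ` S) = f ` X \<longleftrightarrow> \<Union>S = X"
    by (metis image_Union inj inj_image_eq_iff)
  ultimately show ?thesis
    unfolding nc_pairings_def
    by (simp add: card_image inj_on_subset[OF inj] crossing_image[OF f] inj_image_eq_iff[OF inj])
qed

lemma ordered_pairings_image:
  assumes f: "strict_mono (f :: nat \<Rightarrow> nat)"
  shows "ordered_pairings m (f ` X) = map ((`) f) ` ordered_pairings m X"
proof -
  have inj: "inj f" using f by (rule strict_mono_imp_inj_on)
  then have inj': "inj ((`) f)" by (simp add: inj_image_eq_iff inj_def)
  have depth: "block_depth ((`) f ` S) (f ` B) = block_depth S B" for S B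
  proof -
    have "{C \<in> (`) f ` S. nested C (f ` B)} = (`) f ` {C \<in> S. nested C B}"
      using nested_image[OF f] by auto
    then show ?thesis
      unfolding block_depth_def by (simp add: card_image inj_on_subset[OF inj'])
  qed
  have iff: "map ((`) f) P \<in> ordered_pairings m (f ` X) \<longleftrightarrow> P \<in> ordered_pairings m X" for P
    unfolding ordered_pairings_def
    by (simp add: distinct_map inj_on_subset[OF inj'] nc_pairings_image[OF f] sorted_wrt_map
      may_precede_def depth nested_image[OF f] cong: sorted_wrt_rel_cong)
  have "P \<in> map ((`) f) ` ordered_pairings m X" if P: "P \<in> ordered_pairings m (f ` X)" for P
  proof -
    have "B = f ` (f -` B)" if "B \<in> set P" for B
      using P that nc_pairings_block(2)[of "set P" "f ` X" B] unfolding ordered_pairings_def by auto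
    then have "P = map ((`) f) (map ((-`) f) P)"
      by (simp add: map_idI)
    with P iff show ?thesis by (metis image_eqI)
  qed
  with iff show ?thesis by auto
qed

lemma card_ordered_pairings_shift:
  "card (ordered_pairings m {Suc c..c + n}) = card (ordered_pairings m {1..n})"
proof -
  have f: "strict_mono ((+) c)" by (simp add: strict_mono_def)
  have "(+) c ` {1..n} = {Suc c..c + n}" by simp
  moreover have "inj_on (map ((`) ((+) c))) (ordered_pairings m {1..n})"
    by (rule inj_on_subset[OF inj_mapI]) (auto simp: inj_def inj_image_eq_iff)
  ultimately show ?thesis
    using ordered_pairings_image[OF f, of m "{1..n}"] by (metis card_image)
qed

section \<open>Counting and the recursion for the cardinalities\<close>

text \<open>Inside the outer block there are \<open>j - 1\<close> blocks. The outer block either has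
  to come first or can be inserted at any of \<open>j\<close> positions, which gives the factor 1 or
  \<open>j\<close>. The maximum with 1 replaces the threshold 0, arising for
  \<open>m \<le> 1\<close>, by the equivalent threshold 1.\<close>

lemma card_headed_pairings:
  assumes "1 \<le> j"
  shows "card (headed_pairings m (2 * j)) =
    (if m \<le> 1 then 1 else j) * card (ONC2 (2 * (j - 1)) (max 1 (m - 1)))"
proof -
  have q: "1 < 2 * j" using assms by simp
  let ?b = "{1, 2 * j}" and ?I = "ordered_pairings (m - 1) {2..2 * j - 1}"
  have "{2..2 * j - 1} = {Suc 1..1 + 2 * (j - 1)}" using assms by auto
  then have "card ?I = card (ordered_pairings (m - 1) {1..2 * (j - 1)})"
    using card_ordered_pairings_shift[of "m - 1" 1 "2 * (j - 1)"] by (simp only:)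
  also have "\<dots> = card (ONC2 (2 * (j - 1)) (max 1 (m - 1)))"
    by (cases "m - 1") (simp_all add: ONC2_eq_ordered_pairings ordered_pairings_0 max_def)
  finally have card_I: "card ?I = \<dots>" .
  have I: "length P = j - 1 \<and> (\<forall>B\<in>set P. B \<noteq> ?b)" if "P \<in> ?I" for P
  proof -
    have "2 * length P = 2 * (j - 1)"
      using ordered_pairings_length[OF that] assms by simp
    moreover have "B \<subseteq> {2..2 * j - 1}" if "B \<in> set P" for B
      using \<open>P \<in> ?I\<close> nc_pairings_block(2)[OF _ that] unfolding ordered_pairings_def by blast
    ultimately show ?thesis by fastforce
  qed
  show ?thesis
  proof (cases "m \<le> 1")
    case True
    have "headed_pairings m (2 * j) = (#) ?b ` ?I"
    proof (intro equalityI subsetI)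
      fix P assume "P \<in> headed_pairings m (2 * j)"
      then have P: "filter (\<lambda>B. B = ?b) P = [?b]" "filter (\<lambda>B. B \<noteq> ?b) P \<in> ?I" "hd P = ?b"
        using headed_pairings_outer[OF q] True by auto
      obtain P' where P': "P = ?b # P'" using P(1,3) by (cases P) auto
      then have "filter (\<lambda>B. B = ?b) P' = []" using P(1) by simp
      then have "filter (\<lambda>B. B \<noteq> ?b) P' = P'" by (auto simp: filter_empty_conv filter_id_conv)
      then show "P \<in> (#) ?b ` ?I" using P(2) unfolding P' by simp
    next
      fix P assume "P \<in> (#) ?b ` ?I"
      then obtain P' where P': "P = ?b # P'" "P' \<in> ?I" by auto
      have "filter (\<lambda>B. B = ?b) P' = []" "filter (\<lambda>B. B \<noteq> ?b) P' = P'"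
        using I[OF P'(2)] by (auto simp: filter_empty_conv filter_id_conv)
      then show "P \<in> headed_pairings m (2 * j)"
        unfolding headed_pairings_outer[OF q] using P' by simp
    qed
    then show ?thesis using card_I True by (simp add: card_image)
  next
    case False
    have "headed_pairings m (2 * j) =
        {P. filter (\<lambda>B. B = ?b) P \<in> {[?b]} \<and> filter (\<lambda>B. B \<noteq> ?b) P \<in> ?I}"
      using headed_pairings_outer[OF q, of _ m] False by auto
    \<comment> \<open>Inserting the outer block is shuffling a one-element list into a list of
      length \<open>j - 1\<close>, which can be done in \<open>j\<close> ways.\<close>
    also have "card \<dots> = (1 + (j - 1) choose 1) * (card {[?b]} * card ?I)"
      by (rule card_filter_pairs) (use I finite_ordered_pairings in auto)
    finally show ?thesis using card_I False assms by simp
  qed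
qed

text \<open>The summand \<open>j\<close> collects the pairings in which 1 is matched with
  \<open>2 * j\<close>. The binomial coefficient counts the interleavings of the \<open>j\<close>
  blocks up to that point with the \<open>k - j\<close> blocks beyond it.\<close>

theorem card_ONC2_rec:
  assumes "1 \<le> k"
  shows "card (ONC2 (2 * k) m) = (\<Sum>j=1..k. (k choose j) *
    ((if m \<le> 1 then 1 else j) * card (ONC2 (2 * (j - 1)) (max 1 (m - 1))) * card (ONC2 (2 * (k - j)) m)))"
proof -
  let ?W = "\<lambda>j. {P \<in> ordered_pairings m {1..2 * k}. {1, 2 * j} \<in> set P}"
  have "\<exists>j\<in>{1..k}. P \<in> ?W j" if P: "P \<in> ordered_pairings m {1..2 * k}" for P
  proof -
    have S: "set P \<in> nc_pairings {1..2 * k}" using P unfolding ordered_pairings_def by simp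
    then have "1 \<in> \<Union>(set P)" using assms unfolding nc_pairings_def by auto
    then obtain B where B: "B \<in> set P" "1 \<in> B" by blast
    then obtain q where q: "B = {1, q}" "q \<noteq> 1"
      using nc_pairings_block(3)[OF S B(1)] by (metis card_2_iff doubleton_eq_iff insertE singletonD)
    have q': "1 < q" "q \<le> 2 * k"
      using nc_pairings_block(2)[OF S B(1)] q by auto
    \<comment> \<open>The points up to the partner \<open>q\<close> of 1 are paired among
      themselves, so \<open>q\<close> is even.\<close>
    then have "{C \<in> set P. C \<subseteq> {1..q}} \<in> nc_pairings {1..q}"
      using nc_pairings_split[OF q', of "set P"] S B q by simp
    from nc_pairings_card[OF this] obtain j where j: "q = 2 * j" by auto
    then show ?thesis using q' B q P by (intro bexI[of _ j]) auto
  qed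
  then have W: "ordered_pairings m {1..2 * k} = (\<Union>j\<in>{1..k}. ?W j)" by blast
  have "card (\<Union>j\<in>{1..k}. ?W j) = (\<Sum>j=1..k. card (?W j))"
  proof (rule card_UN_disjoint)
    show "\<forall>j\<in>{1..k}. finite (?W j)" using finite_ordered_pairings by auto
    have "i = j" if "P \<in> ?W i" "P \<in> ?W j" for P i j
    proof (rule ccontr)
      assume "i \<noteq> j"
      then have "{1, 2 * i} \<noteq> {1, 2 * j}" by (auto simp: doubleton_eq_iff)
      then have "{1, 2 * i} \<inter> {1, 2 * j} = {}"
        using that nc_pairings_disjoint[of "set P"] unfolding ordered_pairings_def by blast
      then show False by auto
    qed
    then show "\<forall>i\<in>{1..k}. \<forall>j\<in>{1..k}. i \<noteq> j \<longrightarrow> ?W i \<inter> ?W j = {}" by blast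
  qed simp
  also have "\<dots> = (\<Sum>j=1..k. (k choose j) *
    ((if m \<le> 1 then 1 else j) * card (ONC2 (2 * (j - 1)) (max 1 (m - 1))) * card (ONC2 (2 * (k - j)) m)))"
  proof (rule sum.cong[OF refl])
    fix j assume j: "j \<in> {1..k}"
    let ?U = "\<lambda>B. B \<subseteq> {1..2 * j}" and ?R = "ordered_pairings m {2 * j + 1..2 * k}"
    have "?W j = {P. filter ?U P \<in> headed_pairings m (2 * j) \<and> filter (\<lambda>B. \<not> ?U B) P \<in> ?R}"
      using ordered_pairings_split[of "2 * j" "2 * k" _ m] j by auto
    also have "card \<dots> = (j + (k - j) choose j) * (card (headed_pairings m (2 * j)) * card ?R)"
    proof (rule card_filter_pairs)
      show "finite (headed_pairings m (2 * j))" "finite ?R"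
        unfolding headed_pairings_def using finite_ordered_pairings by auto
      show "length P = j \<and> (\<forall>B\<in>set P. ?U B)" if "P \<in> headed_pairings m (2 * j)" for P
        using that ordered_pairings_length[of P m "{1..2 * j}"] nc_pairings_block(2)[of "set P" "{1..2 * j}"]
        unfolding headed_pairings_def ordered_pairings_def by auto
      show "length P = k - j \<and> (\<forall>B\<in>set P. \<not> ?U B)" if P: "P \<in> ?R" for P
      proof (intro conjI ballI notI)
        show "length P = k - j"
          using ordered_pairings_length[OF P] j by auto
        fix B assume B: "B \<in> set P" "?U B"
        have "set P \<in> nc_pairings {2 * j + 1..2 * k}" using P unfolding ordered_pairings_def by simp
        from nc_pairings_block(1,2)[OF this B(1)] B(2) show False by fastforce
      qed
    qed
    also have "card ?R = card (ONC2 (2 * (k - j)) m)"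
      using card_ordered_pairings_shift[of m "2 * j" "2 * (k - j)"] j
      by (simp add: ONC2_eq_ordered_pairings algebra_simps)
    finally show "card (?W j) = (k choose j) *
      ((if m \<le> 1 then 1 else j) * card (ONC2 (2 * (j - 1)) (max 1 (m - 1))) * card (ONC2 (2 * (k - j)) m))"
      using card_headed_pairings[of j m] j by simp
  qed
  finally show ?thesis
    unfolding ONC2_eq_ordered_pairings using W by (metis (no_types, lifting))
qed

lemma card_ONC2_0: "card (ONC2 0 m) = 1"
  by (simp add: ONC2_eq_ordered_pairings ordered_pairings_empty)

subsection \<open>Normalized counts and their generating functions\<close>

text \<open>The moment of order \<open>2 * k\<close> of the \<open>m\<close>-monotone law.\<close>

definition pairing_moment :: "nat \<Rightarrow> nat \<Rightarrow> real" where
  "pairing_moment m k = real (card (ONC2 (2 * k) m)) / fact k"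

lemma pairing_moment_0 [simp]: "pairing_moment m 0 = 1"
  by (simp add: pairing_moment_def card_ONC2_0)

lemma pairing_moment_nonneg: "0 \<le> pairing_moment m k"
  by (simp add: pairing_moment_def)

text \<open>With \<open>j = i + 1\<close>, the factorials turn the binomial coefficient into 1/(j!
  (k - j)!). The inside has only \<open>j - 1\<close> blocks, so a factor 1/j is left over. For
  \<open>m \<ge> 2\<close> the \<open>j\<close> positions of the outer block cancel it; for
  \<open>m \<le> 1\<close> it stays.\<close>

lemma pairing_moment_Suc:
  "pairing_moment m (Suc n) = (\<Sum>i\<le>n.
     pairing_moment (max 1 (m - 1)) i / (if m \<le> 1 then real (Suc i) else 1) * pairing_moment m (n - i))"
proof -
  have n: "1 \<le> Suc n" by simp
  have "pairing_moment m (Suc n) = (\<Sum>j=1..Suc n. real (Suc n choose j) / fact (Suc n) *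
    ((if m \<le> 1 then 1 else real j) * real (card (ONC2 (2 * (j - 1)) (max 1 (m - 1)))) *
      real (card (ONC2 (2 * (Suc n - j)) m))))"
    unfolding pairing_moment_def card_ONC2_rec[OF n] of_nat_sum sum_divide_distrib
    by (rule sum.cong) simp_all
  also have "\<dots> = (\<Sum>i\<le>n. real (Suc n choose Suc i) / fact (Suc n) *
    ((if m \<le> 1 then 1 else real (Suc i)) * real (card (ONC2 (2 * i) (max 1 (m - 1)))) *
      real (card (ONC2 (2 * (n - i)) m))))"
    by (rule sum.reindex_bij_witness[of _ Suc "\<lambda>j. j - 1"]) auto
  also have "\<dots> = (\<Sum>i\<le>n.
     pairing_moment (max 1 (m - 1)) i / (if m \<le> 1 then real (Suc i) else 1) * pairing_moment m (n - i))"
  proof (rule sum.cong[OF refl])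
    fix i assume "i \<in> {..n}"
    then have "real (Suc n choose Suc i) / fact (Suc n) = 1 / (fact (Suc i) * fact (n - i))"
      by (subst binomial_fact) auto
    then show "real (Suc n choose Suc i) / fact (Suc n) *
        ((if m \<le> 1 then 1 else real (Suc i)) * real (card (ONC2 (2 * i) (max 1 (m - 1)))) *
        real (card (ONC2 (2 * (n - i)) m))) =
      pairing_moment (max 1 (m - 1)) i / (if m \<le> 1 then real (Suc i) else 1) * pairing_moment m (n - i)"
      by (simp add: pairing_moment_def fact_Suc del: of_nat_Suc)
  qed
  finally show ?thesis .
qed

text \<open>Division by \<open>i + 1\<close> is integration of the generating function A, so the
  recursion reads A = 1 + A I, where I is the antiderivative of A vanishing at 0. It is solved by A
  = (1 - 2w)^(-1/2), for which I = 1 - (1 - 2w)^(1/2). The proof checks this on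
  coefficients.\<close>

lemma pairing_moment_1:
  "pairing_moment 1 k = ((-1/2) gchoose k) * (-2) ^ k"
proof (induction k rule: less_induct)
  case (less k)
  show ?case
  proof (cases k)
    case (Suc n)
    have "pairing_moment 1 (Suc n) =
        (\<Sum>i\<le>n. pairing_moment 1 i / real (Suc i) * pairing_moment 1 (n - i))"
      by (subst pairing_moment_Suc) simp
    also have "\<dots> = (\<Sum>i\<le>n. - ((1/2) gchoose Suc i) * ((-1/2) gchoose (n - i)) * (-2) ^ Suc n)"
    proof (rule sum.cong[OF refl])
      fix i assume i: "i \<in> {..n}"
      \<comment> \<open>Absorption is the coefficient form of integrating the power -1/2 to the
        power 1/2.\<close>
      have "(-1/2) gchoose i = 2 * (real (Suc i) * ((1/2) gchoose Suc i))"
        using gbinomial_absorption[of i "1/2 :: real"] by simp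
      moreover have "pairing_moment 1 i = ((-1/2) gchoose i) * (-2) ^ i"
        using less.IH[of i] i Suc by simp
      ultimately have "pairing_moment 1 i / real (Suc i) = - ((1/2) gchoose Suc i) * (-2) ^ Suc i"
        by (simp del: of_nat_Suc)
      moreover have "pairing_moment 1 (n - i) = ((-1/2) gchoose (n - i)) * (-2) ^ (n - i)"
        using less.IH[of "n - i"] Suc by simp
      moreover have "(-2 :: real) ^ Suc i * (-2) ^ (n - i) = (-2) ^ Suc n"
        using i by (simp flip: power_add)
      ultimately show "pairing_moment 1 i / real (Suc i) * pairing_moment 1 (n - i) =
          - ((1/2) gchoose Suc i) * ((-1/2) gchoose (n - i)) * (-2) ^ Suc n"
        by (metis (no_types, opaque_lifting) mult.assoc mult.left_commute)
    qed
    also have "\<dots> = - (\<Sum>i\<le>n. ((1/2) gchoose Suc i) * ((-1/2) gchoose (n - i))) * (-2) ^ Suc n"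
      by (simp only: sum_distrib_right sum_negf mult_minus_left)
    also have "(\<Sum>i\<le>n. ((1/2) gchoose Suc i) * ((-1/2) gchoose (n - i))) = - ((-1/2 :: real) gchoose Suc n)"
    proof -
      \<comment> \<open>The exponents 1/2 and -1/2 add up to 0, so Vandermonde yields a coefficient
        of positive index of the constant series 1. Splitting off \<open>i = 0\<close> leaves the
        desired sum.\<close>
      have "(\<Sum>i\<le>Suc n. ((1/2) gchoose i) * ((-1/2 :: real) gchoose (Suc n - i))) = 0"
        using gbinomial_Vandermonde[of "1/2 :: real" "-1/2" "Suc n"] by (simp add: atMost_atLeast0)
      then show ?thesis by (subst (asm) sum.atMost_Suc_shift) simp
    qed
    finally show ?thesis unfolding Suc by simp
  qed simp
qed

section \<open>Geometric growth and convergence of the generating functions\<close>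

text \<open>For \<open>m = 1\<close> consecutive moments have ratio (2k + 1)/(k + 1), which is below
  2. If level \<open>m\<close> is bounded by powers of C, the convolution bounds level
  \<open>m + 1\<close> by powers of C + 1, because the sum in \<open>geo\<close> telescopes to (C +
  1)^(n + 1) - C^(n + 1).\<close>

lemma pairing_moment_le:
  assumes "1 \<le> m"
  shows "pairing_moment m k \<le> real (Suc m) ^ k"
  using assms
proof (induction m arbitrary: k rule: dec_induct)
  case base
  show ?case
  proof (induction k)
    case (Suc k)
    have "real (Suc k) * ((-1/2) gchoose Suc k) = (-1/2 - real k) * ((-1/2) gchoose k)"
      using gbinomial_mult_1[of "-1/2 :: real" k] by (simp add: algebra_simps)
    moreover have "real (Suc k) * pairing_moment 1 (Suc k) =
        (-2) * (-2) ^ k * (real (Suc k) * ((-1/2) gchoose Suc k))"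
      unfolding pairing_moment_1 by simp
    ultimately have "real (Suc k) * pairing_moment 1 (Suc k) =
        (-2) * (-2) ^ k * ((-1/2 - real k) * ((-1/2) gchoose k))"
      by simp
    also have "\<dots> = (2 * real k + 1) * pairing_moment 1 k"
      unfolding pairing_moment_1 by (simp add: algebra_simps)
    also have "\<dots> \<le> (2 * real (Suc k)) * pairing_moment 1 k"
      by (rule mult_right_mono) (auto simp: pairing_moment_nonneg)
    finally have "pairing_moment 1 (Suc k) \<le> 2 * pairing_moment 1 k"
      by (simp del: of_nat_Suc add: mult.assoc mult.left_commute[of 2])
    with Suc show ?case by simp
  qed simp
next
  case (step m)
  define C where "C = real (Suc m)"
  have C: "0 \<le> C" "real (Suc (Suc m)) = C + 1" by (auto simp: C_def)
  have geo: "(\<Sum>i\<le>n. C ^ i * (C + 1) ^ (n - i)) \<le> (C + 1) ^ Suc n" for n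
  proof -
    have "(C + 1) ^ Suc n - C ^ Suc n = (\<Sum>i\<le>n. (C + 1) ^ i * C ^ (n - i))"
      by (subst diff_power_eq_sum) (simp add: lessThan_Suc_atMost)
    also have "\<dots> = (\<Sum>i\<le>n. C ^ i * (C + 1) ^ (n - i))"
      by (rule sum.reindex_bij_witness[of _ "\<lambda>i. n - i" "\<lambda>i. n - i"]) auto
    finally show ?thesis using C(1) by (simp add: algebra_simps)
  qed
  show ?case
  proof (induction k rule: less_induct)
    case (less k)
    show ?case
    proof (cases k)
      case (Suc n)
      have "pairing_moment (Suc m) k = (\<Sum>i\<le>n. pairing_moment m i * pairing_moment (Suc m) (n - i))"
        unfolding Suc by (subst pairing_moment_Suc) (use step in \<open>simp add: max_def\<close>)
      also have "\<dots> \<le> (\<Sum>i\<le>n. C ^ i * (C + 1) ^ (n - i))"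
        using step.IH less.IH C Suc
        by (intro sum_mono mult_mono) (auto simp: pairing_moment_nonneg C_def)
      also have "\<dots> \<le> real (Suc (Suc m)) ^ k"
        unfolding Suc C(2) by (rule geo)
      finally show ?thesis .
    qed simp
  qed
qed

lemma summable_pairing_moment:
  fixes w :: complex
  assumes "1 \<le> m" "norm w * real (Suc m) < 1"
  shows "summable (\<lambda>k. norm (of_real (pairing_moment m k) * w ^ k))"
proof (rule summable_comparison_test')
  show "summable (\<lambda>k. (norm w * real (Suc m)) ^ k)"
    using assms by (intro summable_geometric) simp
  show "norm (norm (of_real (pairing_moment m k) * w ^ k)) \<le> (norm w * real (Suc m)) ^ k" for k
    using mult_right_mono[OF pairing_moment_le[OF assms(1), of k], of "norm w ^ k"]
    by (simp add: norm_mult norm_power pairing_moment_nonneg power_mult_distrib mult.commute del: of_nat_Suc)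
qed

definition pairing_gf :: "nat \<Rightarrow> complex \<Rightarrow> complex" where
  "pairing_gf m w = (\<Sum>k. of_real (pairing_moment m k) * w ^ k)"

lemma pairing_gf_rec:
  assumes "2 \<le> m" "norm w * real (Suc m) < 1"
  shows "pairing_gf m w = 1 + w * (pairing_gf (m - 1) w * pairing_gf m w)"
proof -
  let ?f = "\<lambda>m k. of_real (pairing_moment m k) * w ^ k"
  have "norm w * real (Suc (m - 1)) \<le> norm w * real (Suc m)"
    by (rule mult_left_mono) auto
  then have s: "summable (\<lambda>k. norm (?f (m - 1) k))" "summable (\<lambda>k. norm (?f m k))"
    using assms by (auto intro!: summable_pairing_moment simp del: of_nat_Suc)
  have "w * (pairing_gf (m - 1) w * pairing_gf m w) = (\<Sum>n. w * (\<Sum>i\<le>n. ?f (m - 1) i * ?f m (n - i)))"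
    unfolding pairing_gf_def Cauchy_product[OF s]
    by (rule suminf_mult[symmetric]) (rule summable_Cauchy_product[OF s])
  also have "\<dots> = (\<Sum>n. ?f m (Suc n))"
  proof (rule suminf_cong)
    fix n
    have "?f m (Suc n) = (\<Sum>i\<le>n. of_real (pairing_moment (m - 1) i * pairing_moment m (n - i)) * w ^ Suc n)"
      using assms(1) by (simp add: pairing_moment_Suc max_def sum_distrib_right)
    also have "\<dots> = (\<Sum>i\<le>n. w * (?f (m - 1) i * ?f m (n - i)))"
    proof (rule sum.cong[OF refl])
      fix i assume "i \<in> {..n}"
      then have "w ^ Suc n = w * (w ^ i * w ^ (n - i))" by (simp flip: power_add)
      then show "of_real (pairing_moment (m - 1) i * pairing_moment m (n - i)) * w ^ Suc n =
          w * (?f (m - 1) i * ?f m (n - i))"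
        by (simp only: of_real_mult mult_ac)
    qed
    finally show "w * (\<Sum>i\<le>n. ?f (m - 1) i * ?f m (n - i)) = ?f m (Suc n)"
      by (simp add: sum_distrib_left)
  qed
  also have "\<dots> = pairing_gf m w - 1"
    using suminf_split_head[OF summable_norm_cancel[OF s(2)]] unfolding pairing_gf_def by simp
  finally show ?thesis by simp
qed

text \<open>This is the binomial series with exponent -1/2 at \<open>- 2 * w\<close>, whose
  convergence disc gives the bound 1/2. The principal power obtained here matches the principal
  \<open>csqrt\<close> in \<open>sqrt_z2m2\<close>.\<close>

lemma pairing_gf_1:
  assumes "norm w < 1 / 2"
  shows "pairing_gf 1 w = (1 - 2 * w) powr (-1/2)"
proof -
  have "norm (- 2 * w) < 1" using assms by (simp add: norm_mult)
  from gen_binomial_complex[OF this, of "-1/2"]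
  have "(\<lambda>n. ((-1/2) gchoose n) * (- 2 * w) ^ n) sums (1 - 2 * w) powr (-1/2)" by simp
  moreover have "((-1/2) gchoose n) * (- 2 * w) ^ n = of_real (pairing_moment 1 n) * w ^ n" for n
  proof -
    have "(of_real ((-1/2) gchoose n) :: complex) = (-1/2) gchoose n"
      by (simp add: gbinomial_prod_rev)
    then show ?thesis
      unfolding pairing_moment_1 of_real_mult of_real_power by (simp add: power_mult_distrib[of "-2" w, simplified])
  qed
  ultimately show ?thesis
    unfolding pairing_gf_def by (simp add: sums_iff)
qed

subsection \<open>Cauchy transforms and moments\<close>

text \<open>Finite and exact, hence usable for every real \<open>x\<close>, however large. Terms
  come in even-odd pairs so that the odd moments drop out on integration and the remainder carries
  the nonnegative factor \<open>x ^ (2 * K)\<close> when \<open>x\<close> is real.\<close>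

lemma geometric_expansion:
  fixes z x :: "'a :: field"
  assumes "z \<noteq> 0" "z \<noteq> x"
  shows "1 / (z - x) = (\<Sum>k<K. x ^ (2 * k) / z ^ (2 * k + 1) + x ^ (2 * k + 1) / z ^ (2 * k + 2)) +
    x ^ (2 * K) / z ^ (2 * K) * (1 / (z - x))"
proof (induction K)
  case (Suc K)
  have step: "x ^ (2 * K) / z ^ (2 * K) * (1 / (z - x)) =
    x ^ (2 * K) / z ^ (2 * K + 1) + x ^ (2 * K + 1) / z ^ (2 * K + 2) +
    x ^ (2 * Suc K) / z ^ (2 * Suc K) * (1 / (z - x))"
    using assms by (simp add: divide_simps) (simp add: algebra_simps)
  show ?case
    by (rule trans[OF Suc]) (simp only: step sum.lessThan_Suc add.assoc)
qed simp

context
  fixes M :: "real measure"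
  assumes prob: "prob_space M" and borel: "sets M = sets borel"
begin

interpretation prob_space M by (rule prob)

lemma norm_cauchy_kernel_le:
  assumes "0 < Im z"
  shows "norm (1 / (z - complex_of_real x)) \<le> 1 / Im z"
proof -
  have "Im z \<le> norm (z - complex_of_real x)"
    using abs_Im_le_cmod[of "z - complex_of_real x"] by simp
  then show ?thesis
    using assms by (simp add: norm_divide divide_simps)
qed

lemma borel_measurable_cauchy_kernel:
  "(\<lambda>x. 1 / (z - complex_of_real x)) \<in> borel_measurable M"
proof -
  have "(\<lambda>x. 1 / (z - complex_of_real x)) \<in> borel_measurable borel" by measurable
  then show ?thesis using measurable_cong_sets[OF borel refl] by blast
qed

lemma integrable_cauchy_kernel:
  assumes "0 < Im z"
  shows "integrable M (\<lambda>x. 1 / (z - complex_of_real x))"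
  by (rule integrable_const_bound[of _ "1 / Im z"])
    (use norm_cauchy_kernel_le[OF assms] borel_measurable_cauchy_kernel in auto)

text \<open>After truncation at \<open>K\<close> the error is at most \<open>c K\<close> divided by
  \<open>norm z ^ (2 * K) * Im z\<close>, because the kernel is bounded by \<open>1 / Im z\<close>.
  The moment bound makes this a null sequence once \<open>C < (norm z)\<^sup>2\<close>.\<close>

lemma cauchy_transform_sums:
  assumes z: "0 < Im z"
    and int: "\<And>k. integrable M (\<lambda>x. x ^ k)"
    and odd: "\<And>k. (\<integral>x. x ^ (2 * k + 1) \<partial>M) = 0"
    and even: "\<And>k. (\<integral>x. x ^ (2 * k) \<partial>M) = c k"
    and bound: "\<And>k. c k \<le> C ^ k" "0 \<le> C" "C < (norm z)\<^sup>2"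
  shows "(\<lambda>k. of_real (c k) / z ^ (2 * k + 1)) sums cauchy_transform M z"
proof -
  have z0: "z \<noteq> 0" using z by auto
  have nx: "z \<noteq> complex_of_real x" for x using z by auto
  have intc: "integrable M (\<lambda>x. complex_of_real x ^ k / a)" for k and a :: complex
    using integrable_of_real[OF int[of k], where 'a = complex] by simp
  have momc: "(\<integral>x. complex_of_real x ^ k / a \<partial>M) = of_real (\<integral>x. x ^ k \<partial>M) / a" for k and a :: complex
    using integral_complex_of_real[of M "\<lambda>x. x ^ k"] by simp
  have rem: "norm (cauchy_transform M z - (\<Sum>k<K. of_real (c k) / z ^ (2 * k + 1))) \<le>
      1 / Im z * (C / (norm z)\<^sup>2) ^ K" for K
  proof -
    let ?P = "\<lambda>x. \<Sum>k<K. complex_of_real x ^ (2 * k) / z ^ (2 * k + 1) +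
      complex_of_real x ^ (2 * k + 1) / z ^ (2 * k + 2)"
    have intP: "integrable M ?P"
      by (intro Bochner_Integration.integrable_sum Bochner_Integration.integrable_add intc)
    have "(\<integral>x. ?P x \<partial>M) = (\<Sum>k<K. of_real (c k) / z ^ (2 * k + 1))"
      by (subst Bochner_Integration.integral_sum)
        (intro Bochner_Integration.integrable_add intc,
         simp only: Bochner_Integration.integral_add[OF intc intc] momc even odd, simp)
    then have "cauchy_transform M z - (\<Sum>k<K. of_real (c k) / z ^ (2 * k + 1)) =
        (\<integral>x. 1 / (z - complex_of_real x) - ?P x \<partial>M)"
      unfolding cauchy_transform_def
      by (simp only: Bochner_Integration.integral_diff[OF integrable_cauchy_kernel[OF z] intP])
    also have "norm \<dots> \<le> (\<integral>x. x ^ (2 * K) * (1 / (norm z ^ (2 * K) * Im z)) \<partial>M)"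
    proof (rule Bochner_Integration.integral_norm_bound_integral)
      show "integrable M (\<lambda>x. 1 / (z - complex_of_real x) - ?P x)"
        by (intro Bochner_Integration.integrable_diff integrable_cauchy_kernel[OF z] intP)
      show "integrable M (\<lambda>x. x ^ (2 * K) * (1 / (norm z ^ (2 * K) * Im z)))"
        using int by (intro integrable_mult_left) auto
      fix x
      have "1 / (z - complex_of_real x) - ?P x =
          complex_of_real x ^ (2 * K) / z ^ (2 * K) * (1 / (z - complex_of_real x))"
        unfolding diff_eq_eq by (subst add.commute) (rule geometric_expansion[OF z0 nx])
      then have "norm (1 / (z - complex_of_real x) - ?P x) =
          x ^ (2 * K) / norm z ^ (2 * K) * norm (1 / (z - complex_of_real x))"
        by (simp add: norm_mult norm_divide norm_power power_mult)
      also have "\<dots> \<le> x ^ (2 * K) / norm z ^ (2 * K) * (1 / Im z)"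
        by (intro mult_left_mono norm_cauchy_kernel_le z) (simp add: power_mult)
      finally show "norm (1 / (z - complex_of_real x) - ?P x) \<le>
          x ^ (2 * K) * (1 / (norm z ^ (2 * K) * Im z))"
        by simp
    qed
    also have "\<dots> = c K * (1 / (norm z ^ (2 * K) * Im z))"
      by (simp only: integral_mult_left_zero even)
    also have "\<dots> \<le> C ^ K * (1 / (norm z ^ (2 * K) * Im z))"
      by (rule mult_right_mono[OF bound(1)]) (use z in simp)
    also have "\<dots> = 1 / Im z * (C / (norm z)\<^sup>2) ^ K"
      by (simp add: power_divide power_mult)
    finally show ?thesis .
  qed
  have "(\<lambda>K. 1 / Im z * (C / (norm z)\<^sup>2) ^ K) \<longlonglongrightarrow> 1 / Im z * 0"
    by (intro tendsto_mult_left LIMSEQ_power_zero) (use bound(2,3) z0 in simp)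
  then have "(\<lambda>K. cauchy_transform M z - (\<Sum>k<K. of_real (c k) / z ^ (2 * k + 1))) \<longlonglongrightarrow> 0"
    unfolding mult_zero_right
    by (rule Lim_null_comparison[OF always_eventually, rotated]) (intro allI rem)
  from tendsto_diff[OF tendsto_const[of "cauchy_transform M z"] this] show ?thesis
    unfolding sums_def by simp
qed

text \<open>The difference quotient minus the candidate derivative equals (w - z) times the integral
  of 1/((w - x)(z - x)^2). Restricting to \<open>norm (w - z) < Im z / 2\<close> keeps
  \<open>Im w\<close> above \<open>Im z / 2\<close>, so that integral stays bounded as
  \<open>w\<close> tends to \<open>z\<close>.\<close>

lemma cauchy_transform_holomorphic: "cauchy_transform M holomorphic_on {z. 0 < Im z}"
proof -
  have "(cauchy_transform M has_field_derivative - (\<integral>x. (1 / (z - complex_of_real x))\<^sup>2 \<partial>M)) (at z)"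
    if z: "0 < Im z" for z
  proof -
    let ?k = "\<lambda>z x. 1 / (z - complex_of_real x)"
    have intsq: "integrable M (\<lambda>x. (?k z x)\<^sup>2)"
    proof (rule integrable_const_bound[of _ "(1 / Im z)\<^sup>2"])
      show "AE x in M. norm ((?k z x)\<^sup>2) \<le> (1 / Im z)\<^sup>2"
        unfolding norm_power by (intro AE_I2 power_mono norm_cauchy_kernel_le z) simp
    qed (use borel_measurable_cauchy_kernel in measurable)
    have bound: "norm ((cauchy_transform M w - cauchy_transform M z) / (w - z) -
        - (\<integral>x. (?k z x)\<^sup>2 \<partial>M)) \<le> norm (w - z) * (2 / Im z * (1 / Im z)\<^sup>2)"
      if w: "w \<noteq> z" "norm (w - z) < Im z / 2" for w
    proof -
      have Imw: "Im z / 2 < Im w"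
        using w(2) abs_Im_le_cmod[of "w - z"] by simp
      then have w0: "0 < Im w" using z by simp
      have "(cauchy_transform M w - cauchy_transform M z) / (w - z) - - (\<integral>x. (?k z x)\<^sup>2 \<partial>M) =
          (\<integral>x. (?k w x - ?k z x) / (w - z) + (?k z x)\<^sup>2 \<partial>M)"
        unfolding cauchy_transform_def
        using integrable_cauchy_kernel[OF z] integrable_cauchy_kernel[OF w0] intsq by simp
      also have "\<dots> = (\<integral>x. (w - z) * (?k w x * (?k z x)\<^sup>2) \<partial>M)"
      proof (rule Bochner_Integration.integral_cong[OF refl])
        fix x
        have "z - complex_of_real x \<noteq> 0" "w - complex_of_real x \<noteq> 0" using z w0 by (auto simp: complex_eq_iff)
        moreover have "w - z = (w - complex_of_real x) - (z - complex_of_real x)" by simp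
        ultimately show "(?k w x - ?k z x) / (w - z) + (?k z x)\<^sup>2 = (w - z) * (?k w x * (?k z x)\<^sup>2)"
          using w(1) by (simp add: divide_simps power2_eq_square) (simp add: algebra_simps)
      qed
      also have "norm \<dots> = norm (w - z) * norm (\<integral>x. ?k w x * (?k z x)\<^sup>2 \<partial>M)"
        by (simp only: integral_mult_right_zero norm_mult)
      also have "\<dots> \<le> norm (w - z) * (2 / Im z * (1 / Im z)\<^sup>2)"
      proof (rule mult_left_mono)
        have le: "norm (?k w x * (?k z x)\<^sup>2) \<le> 2 / Im z * (1 / Im z)\<^sup>2" for x
          unfolding norm_mult norm_power
        proof (intro mult_mono power_mono norm_cauchy_kernel_le z)
          have "norm (?k w x) \<le> 1 / Im w" by (rule norm_cauchy_kernel_le[OF w0])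
          also have "\<dots> \<le> 2 / Im z" using Imw z w0 by (simp add: field_simps)
          finally show "norm (?k w x) \<le> 2 / Im z" .
        qed (use z in auto)
        have "integrable M (\<lambda>x. ?k w x * (?k z x)\<^sup>2)"
          by (intro integrable_const_bound[of _ "2 / Im z * (1 / Im z)\<^sup>2"] AE_I2 le
            borel_measurable_times borel_measurable_power borel_measurable_cauchy_kernel)
        then have "norm (\<integral>x. ?k w x * (?k z x)\<^sup>2 \<partial>M) \<le> (\<integral>x. 2 / Im z * (1 / Im z)\<^sup>2 \<partial>M)"
          by (rule Bochner_Integration.integral_norm_bound_integral) (use le in auto)
        then show "norm (\<integral>x. ?k w x * (?k z x)\<^sup>2 \<partial>M) \<le> 2 / Im z * (1 / Im z)\<^sup>2"
          by (simp add: prob_space)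
      qed simp
      finally show ?thesis .
    qed
    have "((\<lambda>w. (cauchy_transform M w - cauchy_transform M z) / (w - z) -
        - (\<integral>x. (?k z x)\<^sup>2 \<partial>M)) \<longlongrightarrow> 0) (at z)"
    proof (rule Lim_null_comparison)
      show "\<forall>\<^sub>F w in at z. norm ((cauchy_transform M w - cauchy_transform M z) / (w - z) -
        - (\<integral>x. (?k z x)\<^sup>2 \<partial>M)) \<le> norm (w - z) * (2 / Im z * (1 / Im z)\<^sup>2)"
        unfolding eventually_at dist_norm
        using bound z by (intro exI[of _ "Im z / 2"]) auto
      have "((\<lambda>w. norm (w - z) * (2 / Im z * (1 / Im z)\<^sup>2)) \<longlongrightarrow> norm (z - z) * (2 / Im z * (1 / Im z)\<^sup>2)) (at z)"
        by (intro tendsto_intros)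
      then show "((\<lambda>w. norm (w - z) * (2 / Im z * (1 / Im z)\<^sup>2)) \<longlongrightarrow> 0) (at z)" by simp
    qed
    then show ?thesis
      unfolding has_field_derivative_iff by (subst (asm) LIM_zero_iff)
  qed
  then show ?thesis
    unfolding holomorphic_on_def field_differentiable_def
    using has_field_derivative_at_within by blast
qed

end

section \<open>Identification of the transforms on the upper half plane\<close>

text \<open>A value \<open>r \<le> 0\<close> would give z^2 = 2/(1 - r), a positive real, and so a
  real \<open>z\<close>. This keeps the argument of \<open>csqrt\<close> off its branch cut and away
  from 0.\<close>

lemma one_minus_two_div_square_notin_nonpos:
  assumes "0 < Im z"
  shows "1 - 2 / z\<^sup>2 \<notin> \<real>\<^sub>\<le>\<^sub>0"
proof
  assume "1 - 2 / z\<^sup>2 \<in> \<real>\<^sub>\<le>\<^sub>0"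
  then obtain r where r: "1 - 2 / z\<^sup>2 = of_real r" "r \<le> 0"
    by (auto elim!: nonpos_Reals_cases)
  have "z \<noteq> 0" using assms by auto
  have "2 / z\<^sup>2 = of_real (1 - r)"
    using r(1) by (simp add: diff_eq_eq eq_diff_eq add.commute)
  then have "2 = z\<^sup>2 * of_real (1 - r)"
    using \<open>z \<noteq> 0\<close> by (simp only: divide_eq_eq mult.commute) simp
  then have "2 = (1 - r) * Re (z\<^sup>2)" "0 = (1 - r) * Im (z\<^sup>2)"
    by (auto simp: complex_eq_iff mult.commute)
  moreover have "0 < 1 - r" using r(2) by simp
  ultimately have "0 < Re (z\<^sup>2)" "Im (z\<^sup>2) = 0"
    by (metis zero_less_mult_pos zero_less_numeral, simp)
  then show False
    using assms by (auto simp: Re_power2 Im_power2)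
qed

lemma cauchy_transform_eq_pairing_gf:
  fixes M :: "real measure"
  assumes M: "prob_space M" "sets M = sets borel"
    and int: "\<And>k. integrable M (\<lambda>x. x ^ k)"
    and odd: "\<And>k. (\<integral>x. x ^ (2 * k + 1) \<partial>M) = 0"
    and even: "\<And>k. (\<integral>x. x ^ (2 * k) \<partial>M) = pairing_moment m k"
    and m: "1 \<le> m" and z: "0 < Im z" "real (Suc m) < (norm z)\<^sup>2"
  shows "cauchy_transform M z = pairing_gf m (1 / z\<^sup>2) / z"
proof -
  have "z \<noteq> 0" using z(1) by auto
  then have "norm (1 / z\<^sup>2) * real (Suc m) < 1"
    using z(2) by (simp add: norm_divide norm_power divide_simps)
  from summable_norm_cancel[OF summable_pairing_moment[OF m this]]
  have "(\<lambda>k. of_real (pairing_moment m k) * (1 / z\<^sup>2) ^ k / z) sums (pairing_gf m (1 / z\<^sup>2) / z)"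
    unfolding pairing_gf_def by (intro sums_divide summable_sums)
  moreover have "of_real (pairing_moment m k) * (1 / z\<^sup>2) ^ k / z =
      of_real (pairing_moment m k) / z ^ (2 * k + 1)" for k
    by (simp add: power_divide power_mult)
  ultimately show ?thesis
    using cauchy_transform_sums[OF M z(1) int odd even pairing_moment_le[OF m] _ z(2)]
    by (simp add: sums_iff)
qed

theorem theorem7p2:
  fixes \<mu> :: "nat \<Rightarrow> real measure"
  assumes prob: "\<And>m. m \<ge> 1 \<Longrightarrow> prob_space (\<mu> m)"
    and borel: "\<And>m. m \<ge> 1 \<Longrightarrow> sets (\<mu> m) = sets borel"
    and integ: "\<And>m k. m \<ge> 1 \<Longrightarrow> integrable (\<mu> m) (\<lambda>x. x ^ k)"
    and odd_mom: "\<And>m k. m \<ge> 1 \<Longrightarrow> (\<integral>x. x ^ (2 * k + 1) \<partial>\<mu> m) = 0"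
    and even_mom: "\<And>m k. m \<ge> 1 \<Longrightarrow>
        (\<integral>x. x ^ (2 * k) \<partial>\<mu> m) = real (card (ONC2 (2 * k) m)) / fact k"
  shows "\<forall>z. Im z > 0 \<longrightarrow>
           cauchy_transform (\<mu> 1) z = 1 / sqrt_z2m2 z \<and>
           (\<forall>m\<ge>2. cauchy_transform (\<mu> m) z = 1 / (z - cauchy_transform (\<mu> (m - 1)) z))"
proof -
  let ?H = "{z. 0 < Im z}"
  \<comment> \<open>The nonempty open region where the moment series converges; equalities valid
    there are continued to the half plane.\<close>
  let ?F = "\<lambda>m. ?H \<inter> {z. sqrt (real (Suc m)) < norm z}"
  have far: "open (?F m)" "?F m \<noteq> {}" "?F m \<subseteq> ?H" for m
  proof -
    show "open (?F m)"
      by (intro open_Int open_halfspace_Im_gt open_Collect_less continuous_intros)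
    have "\<i> * of_real (sqrt (real (Suc m)) + 1) \<in> ?F m"
      by (simp add: norm_mult add_nonneg_pos del: of_real_add of_nat_Suc)
    then show "?F m \<noteq> {}" by blast
  qed auto
  have H: "open ?H" "connected ?H"
    by (auto intro: open_halfspace_Im_gt convex_connected convex_halfspace_Im_gt)
  have hol: "cauchy_transform (\<mu> m) holomorphic_on ?H" if "1 \<le> m" for m
    using cauchy_transform_holomorphic prob borel that by blast
  have far_sq: "real (Suc m) < (norm z)\<^sup>2" if "z \<in> ?F m" for m z
    using that power_strict_mono[of "sqrt (real (Suc m))" "norm z" 2] by simp
  have G: "cauchy_transform (\<mu> m) z = pairing_gf m (1 / z\<^sup>2) / z"
    if "1 \<le> m" "0 < Im z" "real (Suc m) < (norm z)\<^sup>2" for m z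
    by (rule cauchy_transform_eq_pairing_gf)
      (use that prob borel integ odd_mom even_mom in \<open>auto simp: pairing_moment_def\<close>)
  have csqrt_nz: "csqrt (1 - 2 / z\<^sup>2) \<noteq> 0" if "0 < Im z" for z
    using one_minus_two_div_square_notin_nonpos[OF that] by (metis csqrt_eq_0 nonpos_Reals_zero_I)
  have "cauchy_transform (\<mu> 1) z = 1 / sqrt_z2m2 z" if z: "0 < Im z" for z
  proof (rule analytic_continuation_open[where f = "cauchy_transform (\<mu> 1)"
        and g = "\<lambda>z. 1 / sqrt_z2m2 z", OF far(1)[of 1] H(1) far(2) H(2) far(3)])
    have "(\<lambda>z. 1 / (z * csqrt (1 - 2 / z\<^sup>2))) holomorphic_on ?H"
      using one_minus_two_div_square_notin_nonpos csqrt_nz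
      by (intro holomorphic_intros) auto
    then show "(\<lambda>z. 1 / sqrt_z2m2 z) holomorphic_on ?H"
      unfolding sqrt_z2m2_def .
    fix w assume w: "w \<in> ?F 1"
    then have "2 < (norm w)\<^sup>2" "0 < Im w" using far_sq[OF w] by auto
    moreover from this have "norm (1 / w\<^sup>2) < 1 / 2"
      by (simp add: norm_divide norm_power divide_simps)
    ultimately have "cauchy_transform (\<mu> 1) w = (1 - 2 / w\<^sup>2) powr (- 1 / 2) / w"
      using G[of 1 w] pairing_gf_1[of "1 / w\<^sup>2"] by simp
    also have "- 1 / 2 = - (1 / 2 :: complex)" by simp
    also have "(1 - 2 / w\<^sup>2) powr (- (1 / 2)) = 1 / csqrt (1 - 2 / w\<^sup>2)"
      unfolding csqrt_conv_powr powr_minus inverse_eq_divide ..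
    finally show "cauchy_transform (\<mu> 1) w = 1 / sqrt_z2m2 w"
      by (simp add: sqrt_z2m2_def)
  qed (use hol z in auto)
  moreover have "cauchy_transform (\<mu> m) z = 1 / (z - cauchy_transform (\<mu> (m - 1)) z)"
    if m: "2 \<le> m" and z: "0 < Im z" for m z
  proof -
    \<comment> \<open>The product form is continued because both sides are visibly holomorphic. That
      the denominator has no zero in the half plane then follows from the product being 1.\<close>
    have "cauchy_transform (\<mu> m) z * (z - cauchy_transform (\<mu> (m - 1)) z) = 1"
    proof (rule analytic_continuation_open[where g = "\<lambda>z. 1"
          and f = "\<lambda>z. cauchy_transform (\<mu> m) z * (z - cauchy_transform (\<mu> (m - 1)) z)",
          OF far(1)[of m] H(1) far(2) H(2) far(3)])
      show "(\<lambda>z. cauchy_transform (\<mu> m) z * (z - cauchy_transform (\<mu> (m - 1)) z)) holomorphic_on ?H"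
        using m by (intro holomorphic_intros hol) auto
      fix w assume "w \<in> ?F m"
      then have w: "real (Suc m) < (norm w)\<^sup>2" "0 < Im w" "w \<noteq> 0" using far_sq by auto
      then have "norm (1 / w\<^sup>2) * real (Suc m) < 1"
        by (simp add: norm_divide norm_power divide_simps)
      from pairing_gf_rec[OF m this]
      have rec: "pairing_gf m (1 / w\<^sup>2) =
          1 + 1 / w\<^sup>2 * (pairing_gf (m - 1) (1 / w\<^sup>2) * pairing_gf m (1 / w\<^sup>2))" .
      have Gw: "cauchy_transform (\<mu> m) w = pairing_gf m (1 / w\<^sup>2) / w"
        "cauchy_transform (\<mu> (m - 1)) w = pairing_gf (m - 1) (1 / w\<^sup>2) / w"
        using m w by (auto intro!: G)
      have "a / w * (w - b / w) = a - 1 / w\<^sup>2 * (b * a)" for a b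
        using w(3) by (simp add: field_simps power2_eq_square)
      then have "cauchy_transform (\<mu> m) w * (w - cauchy_transform (\<mu> (m - 1)) w) =
          pairing_gf m (1 / w\<^sup>2) - 1 / w\<^sup>2 * (pairing_gf (m - 1) (1 / w\<^sup>2) * pairing_gf m (1 / w\<^sup>2))"
        unfolding Gw .
      also have "\<dots> = 1" using rec by (metis add_diff_cancel_right')
      finally show "cauchy_transform (\<mu> m) w * (w - cauchy_transform (\<mu> (m - 1)) w) = 1" .
    qed (use z in auto)
    then show ?thesis
      by (metis mult_zero_right nonzero_eq_divide_eq zero_neq_one)
  qed
  ultimately show ?thesis by blast
qed

end
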